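(* Suppose $N=2$ or $N=3$. Then $F_t(s)\subseteq V_t(s)$ for all $s\in S$ and all $t<N$.
   Context: Setting (vector-valued Markov decision process). Integers $N\ge2$ and $m\ge1$ are fixed. $S$ is a finite set of states; for each $s\in S$, $A_s$ is a nonempty compact set of actions; $A=\bigcup_{s\in S}A_s$. For $t=1,\dots,N-1$, $s\in S$, $a\in A_s$, $R_t(s,a)\in\mathbb{R}^m$ is a vector reward, with components continuous in $a\in A_s$; $p_t(j\mid s,a)$ is the probability of state $j\in S$ at epoch $t+1$ given action $a$ in state $s$ at epoch $t$, continuous in $a\in A_s$. $R_N(s)\in\mathbb{R}^m$ is the terminal reward. A Markovian decision rule is a map $d:S\to A$ with $d(s)\in A_s$; the set $D$ of decision rules is assumed compact (topology of pointwise convergence). A (Markovian) policy is a sequence $\pi=(d_1,\dots,d_{N-1})$ of decision rules; $P_W$ is the set of all of them. Expected total rewards: $u_N^\pi(s)=R_N(s)$ and, for $t<N$, $u_t^\pi(s)=R_t(s,d_t(s))+\sum_{j\in S}p_t(j\mid s,d_t(s))\,u_{t+1}^\pi(j)$. Set $V_t(s)=\{u_t^\pi(s):\pi\in P_W\}$ for $t\le N$, $s\in S$. Order on $\mathbb{R}^m$: $x\ge y$ iff $x_i\ge y_i$ for all $i$. For $X\subseteq\mathbb{R}^m$, $e(X)=\{x\in X:\forall y\in X,\ y\ge x\Rightarrow y=x\}$. White's equations: define by backward recursion $U_N(s)=\{R_N(s)\}$ and, for $t<N$, $$F_t(s)=\bigl\{R_t(s,a)+\textstyle\sum_{j\in S}p_t(j\mid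 s,a)v_j : a\in A_s,\ v_j\in U_{t+1}(j)\ \text{for all } j\in S\bigr\},\qquad U_t(s)=e(F_t(s)).$$ *)

theory Defs
  imports "HOL-Analysis.Analysis"
begin

record ('s, 'a, 'm) vmdp =
  horizon :: nat
  states :: "'s set"
  actions :: "'s \<Rightarrow> 'a set"
  reward :: "nat \<Rightarrow> 's \<Rightarrow> 'a \<Rightarrow> real ^ 'm::finite"
  final_reward :: "'s \<Rightarrow> real ^ 'm::finite"
  trans_prob :: "nat \<Rightarrow> 's \<Rightarrow> 'a \<Rightarrow> 's \<Rightarrow> real"
    \<comment> \<open>\<open>trans_prob M t s a j\<close> is the probability of moving to \<open>j\<close>
        from \<open>s\<close> under \<open>a\<close> at epoch \<open>t\<close>\<close>

definition decision_rules :: "('s, 'a, 'm::finite) vmdp \<Rightarrow> ('s \<Rightarrow> 'a) set" where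
  "decision_rules M = (\<Pi>\<^sub>E s\<in>states M. actions M s)"

definition policies :: "('s, 'a, 'm::finite) vmdp \<Rightarrow> (nat \<Rightarrow> 's \<Rightarrow> 'a) set" where
  "policies M = (\<Pi>\<^sub>E t\<in>{1..<horizon M}. decision_rules M)"

locale vector_mdp =
  fixes M :: "('s, 'a::topological_space, 'm::finite) vmdp"
  assumes horizon_ge_2: "horizon M \<ge> 2"
    and finite_states: "finite (states M)"
    and actions_nonempty: "\<And>s. s \<in> states M \<Longrightarrow> actions M s \<noteq> {}"
    and actions_compact: "\<And>s. s \<in> states M \<Longrightarrow> compact (actions M s)"
    and reward_continuous:
      "\<And>t s i. t \<in> {1..<horizon M} \<Longrightarrow> s \<in> states M \<Longrightarrow>
        continuous_on (actions M s) (\<lambda>a. reward M t s a $ i)"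
    and trans_prob_nonneg:
      "\<And>t s a j. t \<in> {1..<horizon M} \<Longrightarrow> s \<in> states M \<Longrightarrow> a \<in> actions M s \<Longrightarrow>
        j \<in> states M \<Longrightarrow> trans_prob M t s a j \<ge> 0"
    and trans_prob_sum:
      "\<And>t s a. t \<in> {1..<horizon M} \<Longrightarrow> s \<in> states M \<Longrightarrow> a \<in> actions M s \<Longrightarrow>
        (\<Sum>j\<in>states M. trans_prob M t s a j) = 1"
    and trans_prob_continuous:
      "\<And>t s j. t \<in> {1..<horizon M} \<Longrightarrow> s \<in> states M \<Longrightarrow> j \<in> states M \<Longrightarrow>
        continuous_on (actions M s) (\<lambda>a. trans_prob M t s a j)"
    and decision_rules_compact:
      "compactin (product_topology (\<lambda>_. euclidean) (states M)) (decision_rules M)"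

text \<open>The backward recursions below are meant for epochs \<open>t \<le> horizon M\<close>; beyond the
  horizon they take the terminal value.\<close>

function total_reward ::
  "('s, 'a, 'm::finite) vmdp \<Rightarrow> (nat \<Rightarrow> 's \<Rightarrow> 'a) \<Rightarrow> nat \<Rightarrow> 's \<Rightarrow> real ^ 'm" where
  "total_reward M \<pi> t s =
    (if t < horizon M
     then reward M t s (\<pi> t s)
       + (\<Sum>j\<in>states M. trans_prob M t s (\<pi> t s) j *\<^sub>R total_reward M \<pi> (Suc t) j)
     else final_reward M s)"
  by pat_completeness auto
termination by (relation "Wellfounded.measure (\<lambda>(M, _, t, _). horizon M - t)") auto

declare total_reward.simps [simp del]

definition attainable :: "('s, 'a, 'm::finite) vmdp \<Rightarrow> nat \<Rightarrow> 's \<Rightarrow> (real ^ 'm) set" where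
  "attainable M t s = {total_reward M \<pi> t s | \<pi>. \<pi> \<in> policies M}"

text \<open>The order on \<open>real ^ 'm\<close> is the library's componentwise order (\<open>less_eq_vec_def\<close>).\<close>

definition efficient :: "(real ^ 'm::finite) set \<Rightarrow> (real ^ 'm) set" where
  "efficient X = {x \<in> X. \<forall>y\<in>X. y \<ge> x \<longrightarrow> y = x}"

definition one_step ::
  "('s, 'a, 'm::finite) vmdp \<Rightarrow> nat \<Rightarrow> ('s \<Rightarrow> (real ^ 'm) set) \<Rightarrow> 's \<Rightarrow> (real ^ 'm) set" where
  "one_step M t W s =
    {reward M t s a + (\<Sum>j\<in>states M. trans_prob M t s a j *\<^sub>R v j) | a v.
      a \<in> actions M s \<and> (\<forall>j\<in>states M. v j \<in> W j)}"

function white_U :: "('s, 'a, 'm::finite) vmdp \<Rightarrow> nat \<Rightarrow> 's \<Rightarrow> (real ^ 'm) set" where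
  "white_U M t =
    (if t < horizon M
     then (\<lambda>s. efficient (one_step M t (white_U M (Suc t)) s))
     else (\<lambda>s. {final_reward M s}))"
  by pat_completeness auto
termination by (relation "Wellfounded.measure (\<lambda>(M, t). horizon M - t)") auto

declare white_U.simps [simp del]

definition white_F :: "('s, 'a, 'm::finite) vmdp \<Rightarrow> nat \<Rightarrow> 's \<Rightarrow> (real ^ 'm) set" where
  "white_F M t s = one_step M t (white_U M (Suc t)) s"

end

theory Submission
  imports Defs
begin

text \<open>A point of \<open>white_F M t s\<close> is attainable as soon as the continuation values chosen for the
  different successor states come from one and the same policy. At the last epoch they are terminal
  rewards, which depend on no policy; at the last but one epoch each of them depends on the action
  of one state at the last epoch only, and these actions form a decision rule. For longer horizons
  the choices made for different successors may conflict at a state they share later.\<close>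

text \<open>The recursion reads a policy only at epoch \<open>t\<close> and later. Hence overwriting
  a policy at one epoch leaves its values at all later epochs unchanged.\<close>

lemma total_reward_cong:
  assumes "\<And>k. t \<le> k \<Longrightarrow> \<pi> k = \<sigma> k"
  shows "total_reward M \<pi> t s = total_reward M \<sigma> t s"
  using assms
proof (induction M \<pi> t s rule: total_reward.induct)
  case (1 M \<pi> t s)
  have "total_reward M \<pi> (Suc t) j = total_reward M \<sigma> (Suc t) j" if "t < horizon M" "j \<in> states M" for j
    using 1 that by simp
  then show ?case
    using 1(2)[of t] by (simp add: total_reward.simps[of M _ t s])
qed

lemma total_reward_horizon [simp]: "total_reward M \<pi> (horizon M) s = final_reward M s"
  by (simp add: total_reward.simps[of M \<pi> "horizon M"])

lemma white_U_horizon [simp]: "white_U M (horizon M) s = {final_reward M s}"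
  by (simp add: white_U.simps[of M "horizon M"])

lemma white_U_subset_white_F: "t < horizon M \<Longrightarrow> white_U M t s \<subseteq> white_F M t s"
  by (simp add: white_U.simps[of M t] white_F_def efficient_def)

lemma policies_fun_upd:
  assumes "\<pi> \<in> policies M" "t \<in> {1..<horizon M}" "d \<in> decision_rules M"
  shows "\<pi>(t := d) \<in> policies M"
  using assms unfolding policies_def by (metis PiE_fun_upd insert_absorb)

context vector_mdp
begin

lemma decision_rules_nonempty: "decision_rules M \<noteq> {}"
  using actions_nonempty by (simp add: decision_rules_def PiE_eq_empty_iff)

lemma policies_nonempty: "policies M \<noteq> {}"
  using decision_rules_nonempty by (simp add: policies_def PiE_eq_empty_iff)

text \<open>Overwriting \<open>\<pi>\<close> at epoch \<open>t\<close> by a rule that picks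
  \<open>a\<close> in \<open>s\<close> realises this point, since the continuation values from
  \<open>Suc t\<close> on stay those of \<open>\<pi>\<close>.\<close>

lemma one_step_total_reward_attainable:
  assumes t: "t \<in> {1..<horizon M}" and s: "s \<in> states M" and a: "a \<in> actions M s"
    and \<pi>: "\<pi> \<in> policies M"
  shows "reward M t s a
      + (\<Sum>j\<in>states M. trans_prob M t s a j *\<^sub>R total_reward M \<pi> (Suc t) j) \<in> attainable M t s"
proof -
  \<comment> \<open>Any rule will do: the value at epoch \<open>t\<close> in state \<open>s\<close>
    depends on the rule for epoch \<open>t\<close> only through its action in \<open>s\<close>,
    which is reset to \<open>a\<close>.\<close>
  obtain d where d: "d \<in> decision_rules M"
    using decision_rules_nonempty by blast
  have "d(s := a) \<in> decision_rules M"
    using d s a unfolding decision_rules_def by (metis PiE_fun_upd insert_absorb)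
  then have \<sigma>: "\<pi>(t := d(s := a)) \<in> policies M"
    using \<pi> t policies_fun_upd by blast
  have "total_reward M (\<pi>(t := d(s := a))) (Suc t) j = total_reward M \<pi> (Suc t) j" for j
    by (rule total_reward_cong) simp
  then have "total_reward M (\<pi>(t := d(s := a))) t s = reward M t s a
      + (\<Sum>j\<in>states M. trans_prob M t s a j *\<^sub>R total_reward M \<pi> (Suc t) j)"
    using t by (simp add: total_reward.simps[of M _ t s])
  then show ?thesis
    unfolding attainable_def using \<sigma> by (metis (mono_tags, lifting) mem_Collect_eq)
qed

lemma white_F_subset_attainable_if_common_policy:
  assumes "t \<in> {1..<horizon M}" "s \<in> states M"
    and common: "\<And>v. (\<And>j. j \<in> states M \<Longrightarrow> v j \<in> white_U M (Suc t) j) \<Longrightarrow>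
      \<exists>\<pi>\<in>policies M. \<forall>j\<in>states M. v j = total_reward M \<pi> (Suc t) j"
  shows "white_F M t s \<subseteq> attainable M t s"
proof
  fix x
  assume "x \<in> white_F M t s"
  then obtain a v where a: "a \<in> actions M s"
    and v: "\<And>j. j \<in> states M \<Longrightarrow> v j \<in> white_U M (Suc t) j"
    and x: "x = reward M t s a + (\<Sum>j\<in>states M. trans_prob M t s a j *\<^sub>R v j)"
    unfolding white_F_def one_step_def by blast
  obtain \<pi> where \<pi>: "\<pi> \<in> policies M" "\<And>j. j \<in> states M \<Longrightarrow> v j = total_reward M \<pi> (Suc t) j"
    using common[OF v] by blast
  show "x \<in> attainable M t s"
    using one_step_total_reward_attainable[OF assms(1,2) a \<pi>(1)] x \<pi>(2) by simp
qed

lemma white_F_subset_attainable_last: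
  assumes "1 \<le> t" "Suc t = horizon M" "s \<in> states M"
  shows "white_F M t s \<subseteq> attainable M t s"
proof (rule white_F_subset_attainable_if_common_policy)
  fix v
  assume "\<And>j. j \<in> states M \<Longrightarrow> v j \<in> white_U M (Suc t) j"
  \<comment> \<open>Both sides are the terminal reward, whatever the policy, so any policy is a
    common one.\<close>
  then have "\<forall>j\<in>states M. v j = total_reward M \<pi> (Suc t) j" for \<pi>
    using assms(2) by simp
  then show "\<exists>\<pi>\<in>policies M. \<forall>j\<in>states M. v j = total_reward M \<pi> (Suc t) j"
    using policies_nonempty by blast
qed (use assms in auto)

lemma white_F_subset_attainable_last_but_one:
  assumes "1 \<le> t" "Suc (Suc t) = horizon M" "s \<in> states M"
  shows "white_F M t s \<subseteq> attainable M t s"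
proof (rule white_F_subset_attainable_if_common_policy)
  fix v
  assume v: "\<And>j. j \<in> states M \<Longrightarrow> v j \<in> white_U M (Suc t) j"
  \<comment> \<open>Efficient points are points of \<open>white_F\<close>, and at the last epoch the
    successors contribute fixed terminal rewards, so one action determines
    \<open>v j\<close>.\<close>
  have "\<exists>a\<in>actions M j. v j = reward M (Suc t) j a
      + (\<Sum>k\<in>states M. trans_prob M (Suc t) j a k *\<^sub>R final_reward M k)" if "j \<in> states M" for j
  proof -
    have "v j \<in> white_F M (Suc t) j"
      using v[OF that] white_U_subset_white_F[of "Suc t" M j] assms(2) by auto
    then show ?thesis
      unfolding white_F_def one_step_def using assms(2) by force
  qed
  \<comment> \<open>The actions chosen for distinct \<open>j\<close> sit at distinct arguments of
    one rule, so they cannot conflict.\<close>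
  then obtain f where f: "\<And>j. j \<in> states M \<Longrightarrow> f j \<in> actions M j"
    and v_eq: "\<And>j. j \<in> states M \<Longrightarrow> v j = reward M (Suc t) j (f j)
      + (\<Sum>k\<in>states M. trans_prob M (Suc t) j (f j) k *\<^sub>R final_reward M k)"
    by metis
  obtain \<pi> where "\<pi> \<in> policies M"
    using policies_nonempty by blast
  \<comment> \<open>Decision rules are extensional, so \<open>f\<close> must be
    \<open>undefined\<close> off \<open>states M\<close>.\<close>
  moreover have "restrict f (states M) \<in> decision_rules M"
    using f by (simp add: decision_rules_def)
  ultimately have "\<pi>(Suc t := restrict f (states M)) \<in> policies M"
    using assms(2) by (intro policies_fun_upd) auto
  moreover have "v j = total_reward M (\<pi>(Suc t := restrict f (states M))) (Suc t) j"
    if "j \<in> states M" for j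
    using that assms(2) v_eq by (simp add: total_reward.simps[of M _ "Suc t"])
  ultimately show "\<exists>\<pi>\<in>policies M. \<forall>j\<in>states M. v j = total_reward M \<pi> (Suc t) j"
    by blast
qed (use assms in auto)

end

theorem proposition2:
  fixes M :: "('s, 'a::topological_space, 'm::finite) vmdp"
  assumes "vector_mdp M"
    and "horizon M = 2 \<or> horizon M = 3"
  shows "\<forall>s\<in>states M. \<forall>t\<in>{1..<horizon M}. white_F M t s \<subseteq> attainable M t s"
proof (intro ballI)
  interpret vector_mdp M by fact
  fix s t
  assume s: "s \<in> states M" and t: "t \<in> {1..<horizon M}"
  \<comment> \<open>With at most two decision epochs, each is the last or the last but one.\<close>
  then consider "Suc t = horizon M" | "Suc (Suc t) = horizon M"
    using assms(2) by fastforce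
  then show "white_F M t s \<subseteq> attainable M t s"
    using s t white_F_subset_attainable_last white_F_subset_attainable_last_but_one
    by cases auto
qed

end
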